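(* Let $n,k$ be integers with $n>2$ and $1\le k<n$, and let $S_{n,k}:\Omega_{n,k}\to\mathbb{C}$ be the analytically continued generalized sine function and $\omega_n=e^{2\pi i/n}$. Then for every $z\in\Omega_{n,k}$, $S_{n,k}(\omega_nz)=\omega_nS_{n,k}(z)$.
   Context: Let $n,k$ be integers with $n>2$, $1\le k<n$. For $y\in[0,1]$ let $F_{n,k}(y)=\int_0^y(1-x^n)^{-k/n}\,dx$, let $\varphi_{n,k}=F_{n,k}(1)$ (finite), and let $S_{n,k}:[0,\varphi_{n,k}]\to[0,1]$ be the inverse function of $F_{n,k}$. Let $\omega_n=e^{2\pi i/n}$, $O=0$, $A_{n,k}=\varphi_{n,k}$, $B_{n,k}=\varphi_{n,k}\omega_n$. Closed sets $\Pi_{n,k}$. For $k=1$: $\Pi_{n,1}$ is the closed set whose boundary is the union of the two rays $\{\varphi_{n,1}+te^{i\pi/n}: t\ge0\}$ and $\{\varphi_{n,1}\omega_n+te^{i\pi/n}:t\ge0\}$ and the two segments $OA_{n,1}$, $OB_{n,1}$, and whose interior is the component of $\mathbb{C}\setminus\partial\Pi_{n,1}$ containing $\{te^{i\pi/n}:t>0\}$. For $k>1$: let $P_{n,k}=\varphi_{n,k}e^{i\pi/n}\left(\cos\frac{\pi}{n}+\sin\frac{\pi}{n}\cot\frac{(k-1)\pi}{n}\right)$, which is the point on the ray $\{te^{i\pi/n}:t>0\}$ such that the segment from $A_{n,k}$ to $P_{n,k}$ has angle of inclination $k\pi/n$; then $\Pi_{n,k}$ is the compact set enclosed by the polygon $OA_{n,k}P_{n,k}B_{n,k}$.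 $\Omega_{n,k}$ is the interior of $\bigcup_{j=0}^{n-1}\omega_n^j\cdot\Pi_{n,k}$. The real function $S_{n,k}$ has a unique analytic continuation from $[0,\varphi_{n,k})$ to the domain $\Omega_{n,k}$ (a conformal equivalence of $\Omega_{n,k}$ onto $\mathbb{C}\setminus\bigcup_{j=0}^{n-1}\omega_n^j\cdot[1,\infty)$), again denoted $S_{n,k}$. *)

theory Defs
  imports "HOL-Complex_Analysis.Complex_Analysis"
begin

text \<open>The integrand is unbounded at \<open>x = 1\<close>. It is nonnegative and, for \<open>k < n\<close>, improperly
  integrable, so the Henstock-Kurzweil integral over \<open>{0..1}\<close> is the finite improper integral;
  its value at the single point \<open>x = 1\<close> (where \<open>0 powr a = 0\<close>) is irrelevant.\<close>

definition gen_arcsin :: "nat \<Rightarrow> nat \<Rightarrow> real \<Rightarrow> real" where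
  "gen_arcsin n k y = integral {0..y} (\<lambda>x. (1 - x ^ n) powr (- (real k / real n)))"

definition phi :: "nat \<Rightarrow> nat \<Rightarrow> real" where
  "phi n k = gen_arcsin n k 1"

text \<open>Only meaningful on \<open>{0..phi n k}\<close>.\<close>

definition real_gen_sin :: "nat \<Rightarrow> nat \<Rightarrow> real \<Rightarrow> real" where
  "real_gen_sin n k = the_inv_into {0..1} (gen_arcsin n k)"

definition omega :: "nat \<Rightarrow> complex" where
  "omega n = cis (2 * pi / real n)"

definition pt_A :: "nat \<Rightarrow> nat \<Rightarrow> complex" where
  "pt_A n k = of_real (phi n k)"

definition pt_B :: "nat \<Rightarrow> nat \<Rightarrow> complex" where
  "pt_B n k = of_real (phi n k) * omega n"

definition pt_P :: "nat \<Rightarrow> nat \<Rightarrow> complex" where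
  "pt_P n k = of_real (phi n k) * cis (pi / real n) *
     of_real (cos (pi / real n) + sin (pi / real n) * cot ((real k - 1) * pi / real n))"

definition ray :: "complex \<Rightarrow> real \<Rightarrow> complex set" where
  "ray a \<theta> = {a + of_real t * cis \<theta> | t. t \<ge> 0}"

definition Pi_boundary :: "nat \<Rightarrow> nat \<Rightarrow> complex set" where
  "Pi_boundary n k =
     (if k = 1 then
        ray (pt_A n k) (pi / real n) \<union> ray (pt_B n k) (pi / real n) \<union>
        closed_segment 0 (pt_A n k) \<union> closed_segment 0 (pt_B n k)
      else
        closed_segment 0 (pt_A n k) \<union> closed_segment (pt_A n k) (pt_P n k) \<union>
        closed_segment (pt_P n k) (pt_B n k) \<union> closed_segment (pt_B n k) 0)"

text \<open>In the unbounded case \<open>k = 1\<close> the interior is the component of the complement of the boundary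
  that contains the open ray from \<open>0\<close> in direction \<open>cis (pi / n)\<close>; it is selected here by the
  point of that ray with modulus 1.\<close>

definition Pi_set :: "nat \<Rightarrow> nat \<Rightarrow> complex set" where
  "Pi_set n k = Pi_boundary n k \<union>
     (if k = 1 then connected_component_set (- Pi_boundary n k) (cis (pi / real n))
      else inside (Pi_boundary n k))"

definition Omega :: "nat \<Rightarrow> nat \<Rightarrow> complex set" where
  "Omega n k = interior (\<Union>j<n. (\<lambda>z. omega n ^ j * z) ` Pi_set n k)"

text \<open>\<open>S\<close> is the analytic continuation of the real function from \<open>[0, phi n k)\<close> to \<open>Omega n k\<close>.
  This determines \<open>S\<close> on \<open>Omega n k\<close> only; values elsewhere are unconstrained.\<close>

definition is_gen_sin :: "nat \<Rightarrow> nat \<Rightarrow> (complex \<Rightarrow> complex) \<Rightarrow> bool" where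
  "is_gen_sin n k S \<longleftrightarrow>
     S holomorphic_on Omega n k \<and>
     (\<forall>x\<in>{0..<phi n k}. S (of_real x) = of_real (real_gen_sin n k x))"

end

theory Submission
  imports Defs
begin

text \<open>The power series of the arcsine integral at \<open>0\<close> has only exponents congruent to \<open>1\<close> modulo \<open>n\<close>,
  so it commutes with multiplication by \<open>omega n\<close>; hence so does its inverse \<open>S\<close> near \<open>0\<close>. The set
  \<open>Omega n k\<close> is invariant under this rotation and is starlike about \<open>0\<close>, hence connected, and the
  identity theorem gives the claim. Starlikeness reduces to describing \<open>Pi_set n k\<close>, which is defined
  through its boundary, by two inequalities that are stable under scaling by \<open>t \<le> 1\<close>.\<close>

section \<open>The real arcsine integral: integrability, monotonicity, inverse\<close>

text \<open>Comparison on \<open>{0..1}\<close>: since \<open>x ^ n \<le> x\<close>, the integrand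
  is dominated by \<open>(1 - x) powr (- c)\<close> with \<open>c = k / n < 1\<close>, and this has
  an explicit primitive that stays continuous up to \<open>1\<close>.\<close>

lemma gen_arcsin_integrable:
  fixes n k :: nat and a b :: real
  assumes "1 \<le> n" "k < n" "0 \<le> a" "b \<le> 1"
  shows "(\<lambda>x. (1 - x ^ n) powr (- (real k / real n))) integrable_on {a..b}"
proof -
  define c where "c = real k / real n"
  have c: "0 \<le> c" "c < 1" using assms by (auto simp: c_def)
  have "((\<lambda>x. (1 - x) powr (- c)) has_integral
      (- ((1 - 1) powr (1 - c) / (1 - c)) - - ((1 - 0) powr (1 - c) / (1 - c)))) {0..1::real}"
  proof (rule fundamental_theorem_of_calculus_interior)
    show "continuous_on {0..1::real} (\<lambda>x. - ((1 - x) powr (1 - c) / (1 - c)))"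
      using c by (intro continuous_intros continuous_on_powr') auto
    show "((\<lambda>x. - ((1 - x) powr (1 - c) / (1 - c))) has_vector_derivative (1 - x) powr (- c)) (at x)"
      if "x \<in> {0<..<1}" for x
    proof -
      have "((\<lambda>x. (1 - x) powr (1 - c)) has_real_derivative (1 - c) * (1 - x) powr (1 - c - 1) * (- 1)) (at x)"
        using that by (intro DERIV_chain2[OF has_real_derivative_powr]) (auto intro!: derivative_eq_intros)
      from DERIV_minus[OF DERIV_cdivide[OF this, of "1 - c"]] show ?thesis
        unfolding has_real_derivative_iff_has_vector_derivative[symmetric] using c by simp
    qed
  qed auto
  then have int: "(\<lambda>x. (1 - x) powr (- c)) integrable_on {0..1::real}" by blast
  have "(\<lambda>x. (1 - x ^ n) powr (- c)) integrable_on {0..1::real}"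
  proof (rule measurable_bounded_by_integrable_imp_integrable[OF _ int])
    show "(\<lambda>x::real. (1 - x ^ n) powr (- c)) \<in> borel_measurable (lebesgue_on {0..1})"
      by (intro measurable_restrict_space1 measurable_completion) simp
    show "norm ((1 - x ^ n) powr (- c)) \<le> (1 - x) powr (- c)" if "x \<in> {0..1}" for x :: real
    \<comment> \<open>At \<open>x = 1\<close> both sides are \<open>0\<close>, because
      \<open>0 powr a = 0\<close>.\<close>
    proof (cases "x = 1")
      case False
      then have "x ^ n \<le> x ^ 1"
        using that assms by (intro power_decreasing) auto
      then show ?thesis
        using that False c by (auto intro!: powr_mono2')
    qed auto
  qed auto
  then show ?thesis
    unfolding c_def using assms by (rule_tac integrable_on_subinterval) auto
qed

lemma gen_arcsin_diff:
  assumes "1 \<le> n" "k < n" "0 \<le> x" "x \<le> y" "y \<le> 1"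
  shows "gen_arcsin n k y - gen_arcsin n k x =
    integral {x..y} (\<lambda>x. (1 - x ^ n) powr (- (real k / real n)))"
  using Henstock_Kurzweil_Integration.integral_combine[OF assms(3,4) gen_arcsin_integrable[OF assms(1,2) _ assms(5)]]
  by (simp add: gen_arcsin_def)

text \<open>Away from \<open>1\<close> the integrand is at least \<open>1\<close>, so increments
  dominate lengths.\<close>

lemma gen_arcsin_strict_mono_on:
  assumes "1 \<le> n" "k < n"
  shows "strict_mono_on {0..1} (gen_arcsin n k)"
proof -
  have weak: "gen_arcsin n k x \<le> gen_arcsin n k y" if "0 \<le> x" "x \<le> y" "y \<le> 1" for x y
  proof -
    have "0 \<le> integral {x..y} (\<lambda>x. (1 - x ^ n) powr (- (real k / real n)))"
      by (rule Henstock_Kurzweil_Integration.integral_nonneg) (use gen_arcsin_integrable that assms in auto)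
    then show ?thesis using gen_arcsin_diff[OF assms that] by simp
  qed
  have strict: "gen_arcsin n k x < gen_arcsin n k y" if "0 \<le> x" "x < y" "y < 1" for x y
  proof -
    have "1 \<le> (1 - t ^ n) powr (- (real k / real n))" if "t \<in> {x..y}" for t
    proof -
      have "t ^ n < 1"
        using that \<open>0 \<le> x\<close> \<open>y < 1\<close> assms by (simp add: power_less_one_iff)
      moreover have "0 \<le> t ^ n" using that \<open>0 \<le> x\<close> by simp
      ultimately have "(1::real) powr (- (real k / real n)) \<le> (1 - t ^ n) powr (- (real k / real n))"
        by (intro powr_mono2') auto
      then show ?thesis by simp
    qed
    then have "integral {x..y} (\<lambda>_. 1) \<le> integral {x..y} (\<lambda>x. (1 - x ^ n) powr (- (real k / real n)))"
      by (intro integral_le) (use gen_arcsin_integrable that assms in auto)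
    then show ?thesis using gen_arcsin_diff[OF assms, of x y] that by simp
  qed
  show ?thesis
  proof (rule strict_mono_onI)
    fix x y :: real assume *: "x \<in> {0..1}" "y \<in> {0..1}" "x < y"
    \<comment> \<open>The strict estimate needs a right end below \<open>1\<close>; the midpoint
      provides one, and weak monotonicity covers the rest.\<close>
    have "gen_arcsin n k x < gen_arcsin n k ((x + y) / 2)" using * by (intro strict) auto
    also have "\<dots> \<le> gen_arcsin n k y" using * by (intro weak) auto
    finally show "gen_arcsin n k x < gen_arcsin n k y" .
  qed
qed

lemma gen_arcsin_0 [simp]: "gen_arcsin n k 0 = 0"
  by (simp add: gen_arcsin_def)

lemma gen_arcsin_bounds:
  assumes "1 \<le> n" "k < n" "0 < x" "x < 1"
  shows "0 < gen_arcsin n k x" "gen_arcsin n k x < phi n k"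
  using strict_mono_onD[OF gen_arcsin_strict_mono_on[OF assms(1,2)], of 0 x]
    strict_mono_onD[OF gen_arcsin_strict_mono_on[OF assms(1,2)], of x 1] assms
  by (auto simp: phi_def)

lemma phi_pos:
  assumes "1 \<le> n" "k < n"
  shows "0 < phi n k"
  using gen_arcsin_bounds[OF assms, of "1/2"] by simp

lemma real_gen_sin_gen_arcsin:
  assumes "1 \<le> n" "k < n" "0 \<le> x" "x \<le> 1"
  shows "real_gen_sin n k (gen_arcsin n k x) = x"
  unfolding real_gen_sin_def
  using assms by (intro the_inv_into_f_f strict_mono_on_imp_inj_on gen_arcsin_strict_mono_on) auto

section \<open>The complex primitive and the rotation symmetry of its inverse\<close>

lemma omega_power [simp]: "n > 0 \<Longrightarrow> omega n ^ n = 1"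
  by (simp add: omega_def Complex.DeMoivre)

lemma norm_omega [simp]: "norm (omega n) = 1"
  by (simp add: omega_def)

text \<open>The integrand depends on \<open>z ^ n\<close> only, so its primitive commutes with the rotation by
  \<open>omega n\<close>.\<close>

lemma gen_arcsin_complex:
  assumes "1 \<le> n" "k < n"
  obtains F where "F holomorphic_on ball 0 1"
    "\<And>z. z \<in> ball 0 1 \<Longrightarrow> F (omega n * z) = omega n * F z"
    "\<And>x. 0 \<le> x \<Longrightarrow> x < 1 \<Longrightarrow> F (of_real x) = of_real (gen_arcsin n k x)"
proof -
  define c where "c = real k / real n"
  define g where "g = (\<lambda>z::complex. (1 - z ^ n) powr (of_real (- c)))"
  \<comment> \<open>The base of the power stays in the right half plane, off the branch cut, so
    \<open>g\<close> is holomorphic.\<close>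
  have re: "0 < Re (1 - z ^ n)" if "z \<in> ball 0 1" for z :: complex
  proof -
    have "Re (z ^ n) \<le> norm (z ^ n)" by (rule complex_Re_le_cmod)
    also have "\<dots> < 1" using that assms by (simp add: norm_power power_less_one_iff)
    finally show ?thesis by simp
  qed
  have "g holomorphic_on ball 0 1"
    unfolding g_def
    by (intro holomorphic_intros) (use re complex_nonpos_Reals_iff in force)
  then obtain F0 where F0: "\<And>z. z \<in> ball 0 1 \<Longrightarrow> (F0 has_field_derivative g z) (at z within ball 0 1)"
    using holomorphic_convex_primitive'[of "ball 0 1" g] by auto
  \<comment> \<open>Normalised to vanish at \<open>0\<close>, as the integral from \<open>0\<close>
    does.\<close>
  define F where "F = (\<lambda>z. F0 z - F0 0)"
  have dF: "(F has_field_derivative g z) (at z)" if "z \<in> ball 0 1" for z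
    unfolding F_def using F0[OF that] that
    by (auto intro!: derivative_eq_intros simp: at_within_open[of _ "ball 0 1"])
  have F00: "F 0 = 0" by (simp add: F_def)
  show thesis
  proof
    show "F holomorphic_on ball 0 1"
      unfolding holomorphic_on_open[OF open_ball] by (intro ballI exI, rule dF)
    show "F (omega n * z) = omega n * F z" if "z \<in> ball 0 1" for z
    proof -
      \<comment> \<open>The derivative of \<open>H\<close> is
        \<open>g (omega n * z) * omega n - omega n * g z = 0\<close>, so \<open>H\<close> keeps its
        value \<open>0\<close> from the centre.\<close>
      define H where "H = (\<lambda>z. F (omega n * z) - omega n * F z)"
      have "(H has_field_derivative 0) (at z within ball 0 1)" if "z \<in> ball 0 1" for z
      proof -
        have "((\<lambda>z. F (omega n * z)) has_field_derivative g (omega n * z) * omega n) (at z)"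
          using that by (intro DERIV_chain2[OF dF]) (auto intro!: derivative_eq_intros simp: norm_mult)
        moreover have "g (omega n * z) = g z"
          using assms by (simp add: g_def power_mult_distrib)
        ultimately have "(H has_field_derivative 0) (at z)"
          unfolding H_def using dF[OF that] by (auto intro!: derivative_eq_intros)
        then show ?thesis by (rule has_field_derivative_at_within)
      qed
      then have "\<exists>c. \<forall>x\<in>ball 0 1. H x = c"
        by (rule has_field_derivative_zero_constant[OF convex_ball])
      then have "H z = H 0" using that by (metis centre_in_ball zero_less_one)
      then show ?thesis by (simp add: H_def F00)
    qed
    show "F (of_real x) = of_real (gen_arcsin n k x)" if "0 \<le> x" "x < 1" for x
    proof -
      have "((\<lambda>t. g (of_real t)) has_integral F (of_real x) - F (of_real 0)) {0..x}"
      proof (rule fundamental_theorem_of_calculus)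
        show "((\<lambda>t. F (complex_of_real t)) has_vector_derivative g (of_real t)) (at t within {0..x})"
          if "t \<in> {0..x}" for t
          by (rule has_vector_derivative_real_field[OF has_field_derivative_at_within[OF dF]])
            (use that \<open>x < 1\<close> in simp)
      qed (use that in auto)
      moreover have "((\<lambda>t. g (of_real t)) has_integral of_real (gen_arcsin n k x)) {0..x}"
      proof -
        have *: "((\<lambda>t. complex_of_real ((1 - t ^ n) powr (- c))) has_integral of_real (gen_arcsin n k x)) {0..x}"
          unfolding gen_arcsin_def c_def
          by (intro has_integral_of_real integrable_integral gen_arcsin_integrable) (use that assms in auto)
        have "g (of_real t) = complex_of_real ((1 - t ^ n) powr (- c))" if "t \<in> {0..x}" for t
        proof -
          \<comment> \<open>A nonnegative base makes the complex power agree with the real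
            one.\<close>
          have "t ^ n \<le> 1" using that \<open>x < 1\<close> by (intro power_le_one) auto
          then show ?thesis
            unfolding g_def using powr_of_real[of "1 - t ^ n" "- c"] by simp
        qed
        then show ?thesis by (intro has_integral_eq[OF _ *]) simp
      qed
      ultimately have "F (of_real x) - F (of_real 0) = of_real (gen_arcsin n k x)"
        by (rule has_integral_unique)
      then show ?thesis using F00 by simp
    qed
  qed
qed

text \<open>Two uses of the identity theorem. Near \<open>0\<close>, \<open>S\<close> inverts
  \<open>F\<close>, because it does so at small positive reals. Hence \<open>S\<close> commutes with
  the rotation at the points \<open>F x\<close>, which accumulate at \<open>0\<close>, and
  connectedness spreads this over \<open>Omega n k\<close>.\<close>

lemma is_gen_sin_omega:
  assumes n: "1 \<le> n" "k < n"
    and S: "is_gen_sin n k S"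
    and conn: "connected (Omega n k)" and zero: "0 \<in> Omega n k"
    and rot: "\<And>z. z \<in> Omega n k \<Longrightarrow> omega n * z \<in> Omega n k"
    and z: "z \<in> Omega n k"
  shows "S (omega n * z) = omega n * S z"
proof -
  have op: "open (Omega n k)" by (simp add: Omega_def)
  have hol: "S holomorphic_on Omega n k"
    and real: "\<And>x. 0 \<le> x \<Longrightarrow> x < phi n k \<Longrightarrow> S (of_real x) = of_real (real_gen_sin n k x)"
    using S by (auto simp: is_gen_sin_def)
  obtain F where F: "F holomorphic_on ball 0 1"
    "\<And>z. z \<in> ball 0 1 \<Longrightarrow> F (omega n * z) = omega n * F z"
    "\<And>x. 0 \<le> x \<Longrightarrow> x < 1 \<Longrightarrow> F (of_real x) = of_real (gen_arcsin n k x)"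
    using gen_arcsin_complex[OF n] by blast
  have F0: "F 0 = 0" using F(3)[of 0] by simp
  have cont: "continuous_on (ball 0 1) F" using F(1) by (rule holomorphic_on_imp_continuous_on)
  then have isC: "isCont F 0" by (simp add: continuous_on_eq_continuous_at)
  \<comment> \<open>The radius \<open>r\<close> is to keep \<open>F\<close> inside
    \<open>Omega n k\<close>, where \<open>S\<close> is holomorphic.\<close>
  have "open (ball 0 1 \<inter> F -` Omega n k)"
    using cont op by (simp add: continuous_on_open_vimage Int_commute)
  moreover have "0 \<in> ball 0 1 \<inter> F -` Omega n k" using F0 zero by simp
  ultimately obtain r where r: "r > 0" "ball 0 r \<subseteq> ball 0 1 \<inter> F -` Omega n k"
    using open_contains_ball by blast
  have r1: "x < 1" if "0 \<le> x" "x < r" for x :: real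
  proof -
    have "complex_of_real x \<in> ball 0 r" using that by simp
    then show ?thesis using r that by fastforce
  qed
  have SF: "S (F w) = w" if "w \<in> ball 0 r" for w
  proof -
    have "S (F w) - w = 0"
    proof (rule analytic_continuation[of "\<lambda>w. S (F w) - w" "ball 0 r" "of_real ` {0<..<r}" 0 w])
      have "(S \<circ> F) holomorphic_on ball 0 r"
        using r by (intro holomorphic_on_compose_gen[OF _ hol] holomorphic_on_subset[OF F(1)]) auto
      then show "(\<lambda>w. S (F w) - w) holomorphic_on ball 0 r"
        by (auto intro!: holomorphic_intros simp: o_def)
      show "0 islimpt complex_of_real ` {0<..<r}"
        unfolding islimpt_approachable
      proof safe
        fix e :: real assume "e > 0"
        define x where "x = min r e / 2"
        have "x \<in> {0<..<r}" "x < e" using r \<open>e > 0\<close> by (auto simp: x_def)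
        then show "\<exists>x'\<in>complex_of_real ` {0<..<r}. x' \<noteq> 0 \<and> dist x' 0 < e"
          by (intro bexI[of _ "complex_of_real x"]) auto
      qed
      \<comment> \<open>At a real \<open>x\<close> in \<open>{0<..<r}\<close>, \<open>F x\<close> is
        the real arcsine value, lying strictly between \<open>0\<close> and \<open>phi n k\<close>,
        where \<open>S\<close> is the real inverse.\<close>
      show "S (F z) - z = 0" if "z \<in> of_real ` {0<..<r}" for z
        using that F(3) r1 real gen_arcsin_bounds[OF n] real_gen_sin_gen_arcsin[OF n]
        by (auto simp: less_imp_le)
    qed (use r that in auto)
    then show ?thesis by simp
  qed
  have "S (omega n * z) - omega n * S z = 0"
  proof (rule analytic_continuation[of "\<lambda>z. S (omega n * z) - omega n * S z" "Omega n k" "F ` of_real ` {0<..<r}" 0 z])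
    have "(S \<circ> (\<lambda>z. omega n * z)) holomorphic_on Omega n k"
      using rot by (intro holomorphic_on_compose_gen[OF _ hol] holomorphic_intros) auto
    then show "(\<lambda>z. S (omega n * z) - omega n * S z) holomorphic_on Omega n k"
      using hol by (auto intro!: holomorphic_intros simp: o_def)
    show "0 islimpt F ` complex_of_real ` {0<..<r}"
      unfolding islimpt_approachable
    proof safe
      fix e :: real assume "e > 0"
      then obtain d where d: "d > 0" "\<And>x. dist x 0 < d \<Longrightarrow> dist (F x) (F 0) < e"
        using isC unfolding continuous_at_eps_delta by metis
      define x where "x = min r d / 2"
      have x: "0 < x" "x < r" "x < d" using d r by (auto simp: x_def)
      \<comment> \<open>A limit point requires points other than \<open>0\<close>; the arcsine
        integral is positive for \<open>x > 0\<close>.\<close>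
      have "F (of_real x) \<noteq> 0"
        using F(3)[of x] gen_arcsin_bounds[OF n, of x] r1[of x] x by simp
      moreover have "dist (F (of_real x)) 0 < e" using d(2)[of "of_real x"] x F0 by simp
      ultimately show "\<exists>x'\<in>F ` complex_of_real ` {0<..<r}. x' \<noteq> 0 \<and> dist x' 0 < e"
        using x by (intro bexI[of _ "F (of_real x)"]) auto
    qed
    show "F ` complex_of_real ` {0<..<r} \<subseteq> Omega n k"
    proof safe
      fix x assume "x \<in> {0<..<r}"
      then have "complex_of_real x \<in> ball 0 r" by simp
      then show "F (complex_of_real x) \<in> Omega n k" using r by blast
    qed
    show "S (omega n * w) - omega n * S w = 0" if w: "w \<in> F ` of_real ` {0<..<r}" for w
    proof -
      obtain x where "x \<in> {0<..<r}" "w = F (of_real x)" using w by blast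
      then have x: "0 < x" "x < r" "w = F (of_real x)" by auto
      have "S (omega n * w) = S (F (omega n * of_real x))"
        using F(2) r1[of x] x by simp
      also have "\<dots> = omega n * of_real x" using x by (intro SF) (simp add: norm_mult)
      also have "\<dots> = omega n * S w" using SF[of "of_real x"] x by simp
      finally show ?thesis by simp
    qed
  qed (use op conn zero z in auto)
  then show ?thesis by simp
qed

section \<open>Recovering a bounded starlike set from its boundary\<close>

text \<open>A component of \<open>- B\<close> that starts in \<open>T\<close> cannot cross the
  frontier, so it stays in the bounded set \<open>T\<close>. From a point outside \<open>T\<close>
  the outward radial ray avoids \<open>T\<close>, hence \<open>B\<close>, so its component is
  unbounded.\<close>

lemma starshaped_eq_Un_inside:
  fixes T B :: "'a::euclidean_space set"
  assumes "frontier T \<subseteq> B" "B \<subseteq> T" "bounded T" "0 \<in> T"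
    and star: "\<And>z t. z \<in> T \<Longrightarrow> 0 \<le> t \<Longrightarrow> t \<le> 1 \<Longrightarrow> t *\<^sub>R z \<in> T"
  shows "B \<union> inside B = T"
proof
  show "T \<subseteq> B \<union> inside B"
  proof
    fix z assume z: "z \<in> T"
    show "z \<in> B \<union> inside B"
    proof (cases "z \<in> B")
      case False
      let ?C = "connected_component_set (- B) z"
      have "z \<in> ?C" using False by simp
      moreover have "?C \<subseteq> - B" by (rule connected_component_subset)
      ultimately have "?C - T = {}"
        using connected_Int_frontier[of ?C T] z assms(1) by blast
      then have "bounded ?C" using assms(3) by (blast intro: bounded_subset)
      then show ?thesis using False by (simp add: inside_def)
    qed simp
  qed
  have "z \<in> T" if "z \<in> inside B" for z
  proof (rule ccontr)
    assume z: "z \<notin> T"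
    then have "z \<noteq> 0" using assms(4) by auto
    let ?R = "(\<lambda>t. t *\<^sub>R z) ` {1..}"
    have "connected ?R"
      by (intro connected_continuous_image continuous_intros) auto
    moreover have "?R \<subseteq> - B"
    proof safe
      fix t :: real assume t: "t \<ge> 1" "t *\<^sub>R z \<in> B"
      \<comment> \<open>Shrinking \<open>t *\<^sub>R z\<close> back by \<open>1 / t\<close> would
        put \<open>z\<close> into \<open>T\<close>.\<close>
      then show False using star[of "t *\<^sub>R z" "1 / t"] assms(2) z by auto
    qed
    moreover have "z \<in> ?R" by (intro image_eqI[of _ _ 1]) auto
    ultimately have "?R \<subseteq> connected_component_set (- B) z"
      by (intro connected_component_maximal)
    then have "bounded ?R"
      using that by (auto simp: inside_def intro: bounded_subset)
    then obtain b where b: "\<And>t. t \<ge> 1 \<Longrightarrow> norm (t *\<^sub>R z) \<le> b"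
      by (auto simp: bounded_iff)
    \<comment> \<open>This factor is admissible on the ray and stretches \<open>z\<close> to norm at
      least \<open>b + 1\<close>, past the bound.\<close>
    have "1 \<le> max 1 ((b + 1) / norm z)" by simp
    from b[OF this] have "max 1 ((b + 1) / norm z) * norm z \<le> b" by simp
    moreover have "(b + 1) / norm z * norm z \<le> max 1 ((b + 1) / norm z) * norm z"
      by (intro mult_right_mono) auto
    ultimately show False using \<open>z \<noteq> 0\<close> by simp
  qed
  then show "B \<union> inside B \<subseteq> T" using assms(2) by auto
qed

section \<open>The boundary of \<open>Pi_set\<close> in coordinates along and across the
  bisector\<close>

text \<open>Here \<open>u\<close> is the coordinate along the bisector and \<open>m\<close> the
  absolute value of the transverse one, so each edge stands for a mirror pair. \<open>s\<close> is
  the length from \<open>O\<close> along \<open>O A\<close>, \<open>t\<close> the length from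
  \<open>A\<close> in direction \<open>(cb, - sb)\<close>. The bound
  \<open>t * sb \<le> \<phi> * sa\<close> says \<open>m \<ge> 0\<close>: it stops the edge at
  \<open>P\<close>, and for \<open>sb = 0\<close> it leaves an infinite ray.\<close>

lemma edge_coordinates_iff:
  fixes ca sa cb sb \<phi> u m :: real
  assumes pos: "ca > 0" "sa > 0" "sa * cb + ca * sb > 0"
    and unit: "ca\<^sup>2 + sa\<^sup>2 = 1" "cb\<^sup>2 + sb\<^sup>2 = 1" and "0 \<le> \<phi>"
    and m: "0 \<le> m"
  shows "(m * ca \<le> u * sa \<and> u * sb + m * cb \<le> \<phi> * (sa * cb + ca * sb) \<and>
           (m * ca = u * sa \<or> u * sb + m * cb = \<phi> * (sa * cb + ca * sb))) \<longleftrightarrow>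
         (\<exists>s. 0 \<le> s \<and> s \<le> \<phi> \<and> u = s * ca \<and> m = s * sa) \<or>
         (\<exists>t. 0 \<le> t \<and> t * sb \<le> \<phi> * sa \<and> u = \<phi> * ca + t * cb \<and> m = \<phi> * sa - t * sb)"
    (is "?L \<longleftrightarrow> ?R1 \<or> ?R2")
proof
  assume L: ?L
  show "?R1 \<or> ?R2"
  proof (cases "m * ca = u * sa")
    case True
    define s where "s = m / sa"
    have s: "m = s * sa" "u = s * ca" "0 \<le> s"
      using True pos m by (auto simp: s_def field_simps)
    \<comment> \<open>On the line through \<open>O\<close> the edge inequality takes this form and
      cuts off at \<open>s = \<phi>\<close>.\<close>
    have "s * (sa * cb + ca * sb) \<le> \<phi> * (sa * cb + ca * sb)"
      using L s by (simp add: algebra_simps)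
    then show ?thesis using s pos by auto
  next
    case False
    then have eq: "u * sb + m * cb = \<phi> * (sa * cb + ca * sb)" using L by blast
    \<comment> \<open>The inner product of \<open>(u, m) - (\<phi> * ca, \<phi> * sa)\<close> with
      the unit direction \<open>(cb, - sb)\<close>.\<close>
    define t where "t = (u - \<phi> * ca) * cb + (\<phi> * sa - m) * sb"
    have eq': "(u - \<phi> * ca) * sb = (\<phi> * sa - m) * cb" using eq by (simp add: algebra_simps)
    have "t * cb = (u - \<phi> * ca) * cb\<^sup>2 + ((\<phi> * sa - m) * cb) * sb"
      by (simp add: t_def algebra_simps power2_eq_square)
    also have "\<dots> = (u - \<phi> * ca) * (cb\<^sup>2 + sb\<^sup>2)"
      unfolding eq'[symmetric] by (simp add: algebra_simps power2_eq_square)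
    finally have tc: "t * cb = u - \<phi> * ca" using unit by simp
    have "t * sb = ((u - \<phi> * ca) * sb) * cb + (\<phi> * sa - m) * sb\<^sup>2"
      by (simp add: t_def algebra_simps power2_eq_square)
    also have "\<dots> = (\<phi> * sa - m) * (cb\<^sup>2 + sb\<^sup>2)"
      unfolding eq' by (simp add: algebra_simps power2_eq_square)
    finally have ts: "t * sb = \<phi> * sa - m" using unit by simp
    have um: "u = \<phi> * ca + t * cb" "m = \<phi> * sa - t * sb" using tc ts by auto
    \<comment> \<open>Turns the sector inequality into \<open>t \<ge> 0\<close>.\<close>
    have "t * (sa * cb + ca * sb) = u * sa - m * ca"
      unfolding um by (simp add: algebra_simps)
    then have "0 \<le> t * (sa * cb + ca * sb)" using L by simp
    then have "0 \<le> t" using pos by (simp add: zero_le_mult_iff)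
    with um show ?thesis using m by auto
  qed
next
  assume "?R1 \<or> ?R2"
  then show ?L
  proof
    assume ?R1
    then obtain s where s: "0 \<le> s" "s \<le> \<phi>" "u = s * ca" "m = s * sa" by blast
    have "s * (sa * cb + ca * sb) \<le> \<phi> * (sa * cb + ca * sb)"
      using s pos by (intro mult_right_mono) auto
    then show ?L using s by (simp add: algebra_simps)
  next
    assume ?R2
    then obtain t where t: "0 \<le> t" "u = \<phi> * ca + t * cb" "m = \<phi> * sa - t * sb" by blast
    have "u * sa - m * ca = t * (sa * cb + ca * sb)"
      unfolding t by (simp add: algebra_simps)
    moreover have "0 \<le> t * (sa * cb + ca * sb)" using t pos by simp
    moreover have "u * sb + m * cb = \<phi> * (sa * cb + ca * sb)"
      unfolding t by (simp add: algebra_simps)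
    ultimately show ?L by simp
  qed
qed

text \<open>In the coordinates \<open>z * cis (- pi / n) = u + \<i> * v\<close> the set \<open>Pi_set n k\<close> is symmetric under
  \<open>v \<mapsto> - v\<close>. The function \<open>sector_gap\<close> is nonnegative on the sector bounded by the rays through
  \<open>A\<close> and \<open>B\<close>, and \<open>edge_gap\<close> is nonnegative on the side of the edges \<open>A P\<close> and \<open>B P\<close> (parallel
  rays for \<open>k = 1\<close>) that contains \<open>0\<close>.\<close>

definition sector_gap :: "nat \<Rightarrow> complex \<Rightarrow> real" where
  "sector_gap n z = Re (cis (- (pi / real n)) * z) * sin (pi / real n) -
     \<bar>Im (cis (- (pi / real n)) * z)\<bar> * cos (pi / real n)"

definition edge_gap :: "nat \<Rightarrow> nat \<Rightarrow> complex \<Rightarrow> real" where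
  "edge_gap n k z = phi n k * sin (real k * pi / real n) -
     (Re (cis (- (pi / real n)) * z) * sin ((real k - 1) * pi / real n) +
      \<bar>Im (cis (- (pi / real n)) * z)\<bar> * cos ((real k - 1) * pi / real n))"

text \<open>An explicit replacement for the topologically defined \<open>Pi_set n k\<close>; the
  same two inequalities serve \<open>k = 1\<close> and \<open>k > 1\<close>.\<close>

definition cell :: "nat \<Rightarrow> nat \<Rightarrow> complex set" where
  "cell n k = {z. 0 \<le> sector_gap n z \<and> 0 \<le> edge_gap n k z}"

lemma gap_cis:
  "sector_gap n (cis (pi / real n) * w) =
     Re w * sin (pi / real n) - \<bar>Im w\<bar> * cos (pi / real n)"
  "edge_gap n k (cis (pi / real n) * w) = phi n k * sin (real k * pi / real n) -
     (Re w * sin ((real k - 1) * pi / real n) + \<bar>Im w\<bar> * cos ((real k - 1) * pi / real n))"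
proof -
  have "cis (- (pi / real n)) * (cis (pi / real n) * w) = w"
    by (simp add: cis_mult flip: mult.assoc)
  then show "sector_gap n (cis (pi / real n) * w) =
     Re w * sin (pi / real n) - \<bar>Im w\<bar> * cos (pi / real n)"
  "edge_gap n k (cis (pi / real n) * w) = phi n k * sin (real k * pi / real n) -
     (Re w * sin ((real k - 1) * pi / real n) + \<bar>Im w\<bar> * cos ((real k - 1) * pi / real n))"
    unfolding sector_gap_def edge_gap_def by presburger+
qed

lemma cis_rotate_obtain:
  obtains w where "z = cis a * w"
proof
  show "z = cis a * (cis (- a) * z)" by (simp add: cis_mult flip: mult.assoc)
qed

lemma angle_facts:
  fixes n k :: nat
  assumes "n > 2" "1 \<le> k" "k < n"
  shows "cos (pi / real n) > 0" "sin (pi / real n) > 0"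
    "sin (real k * pi / real n) > 0"
    "sin (real k * pi / real n) = sin (pi / real n) * cos ((real k - 1) * pi / real n) +
       cos (pi / real n) * sin ((real k - 1) * pi / real n)"
    "k \<noteq> 1 \<Longrightarrow> sin ((real k - 1) * pi / real n) > 0"
proof -
  have "pi / real n < pi / 2" using assms by (intro divide_strict_left_mono) auto
  moreover have "0 < pi / real n" using assms by simp
  ultimately show "cos (pi / real n) > 0" by (intro cos_gt_zero_pi) linarith+
  show "sin (pi / real n) > 0" using assms by (intro sin_gt_zero) (auto simp: field_simps)
  show "sin (real k * pi / real n) > 0" using assms by (intro sin_gt_zero) (auto simp: field_simps)
  have "real k * pi / real n = pi / real n + (real k - 1) * pi / real n"
    using assms by (simp add: field_simps)
  then show "sin (real k * pi / real n) = sin (pi / real n) * cos ((real k - 1) * pi / real n) +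
       cos (pi / real n) * sin ((real k - 1) * pi / real n)"
    by (simp only: sin_add)
  show "sin ((real k - 1) * pi / real n) > 0" if "k \<noteq> 1"
  proof (rule sin_gt_zero)
    have "(real k - 1) * pi < real n * pi" using assms by (intro mult_strict_right_mono) auto
    then show "(real k - 1) * pi / real n < pi" using assms by (simp add: field_simps)
    show "0 < (real k - 1) * pi / real n" using assms that by simp
  qed
qed

text \<open>After the rotation by \<open>- \<alpha>\<close> the two edges have directions
  \<open>cis (- \<alpha>)\<close> and \<open>cis \<alpha>\<close>, so they differ only in the sign
  of \<open>Im w\<close>.\<close>

lemma mem_edge_OA_OB_iff:
  fixes \<phi> \<alpha> :: real and w :: complex
  assumes "0 \<le> \<phi>"
  shows "cis \<alpha> * w \<in> closed_segment 0 (of_real \<phi>) \<union> closed_segment 0 (of_real \<phi> * cis (2 * \<alpha>)) \<longleftrightarrow>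
    (\<exists>s. 0 \<le> s \<and> s \<le> \<phi> \<and> Re w = s * cos \<alpha> \<and> \<bar>Im w\<bar> = \<bar>s * sin \<alpha>\<bar>)"
proof -
  have seg: "closed_segment 0 (of_real \<phi> * c) = {of_real s * c | s. 0 \<le> s \<and> s \<le> \<phi>}" for c :: complex
  proof (cases "\<phi> = 0")
    case False
    show ?thesis
    proof safe
      fix x assume "x \<in> closed_segment 0 (of_real \<phi> * c)"
      then obtain t where t: "0 \<le> t" "t \<le> 1" "x = t *\<^sub>R (of_real \<phi> * c)" by (auto simp: in_segment)
      then show "\<exists>s. x = of_real s * c \<and> 0 \<le> s \<and> s \<le> \<phi>"
        using assms by (intro exI[of _ "t * \<phi>"]) (auto simp: scaleR_conv_of_real mult_left_le_one_le)
    next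
      fix s assume "0 \<le> s" "s \<le> \<phi>"
      then show "of_real s * c \<in> closed_segment 0 (of_real \<phi> * c)"
        using False assms unfolding in_segment
        by (intro exI[of _ "s / \<phi>"]) (auto simp: scaleR_conv_of_real)
    qed
  qed auto
  have A: "cis \<alpha> * w = of_real s \<longleftrightarrow> w = of_real s * cis (- \<alpha>)" for s
    by (metis (no_types, lifting) cis_inverse cis_neq_zero divide_inverse mult.commute nonzero_eq_divide_eq)
  have B: "cis \<alpha> * w = of_real s * cis (2 * \<alpha>) \<longleftrightarrow> w = of_real s * cis \<alpha>" for s
  proof -
    have "cis (2 * \<alpha>) = cis \<alpha> * cis \<alpha>" by (simp add: cis_mult)
    then show ?thesis by (metis cis_neq_zero mult.left_commute mult_left_cancel)
  qed
  have "cis \<alpha> * w \<in> closed_segment 0 (of_real \<phi>) \<union> closed_segment 0 (of_real \<phi> * cis (2 * \<alpha>)) \<longleftrightarrow>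
     (\<exists>s. 0 \<le> s \<and> s \<le> \<phi> \<and> (w = of_real s * cis (- \<alpha>) \<or> w = of_real s * cis \<alpha>))"
    using seg[of 1] seg[of "cis (2 * \<alpha>)"] by (auto simp: A B)
  also have "\<dots> \<longleftrightarrow> (\<exists>s. 0 \<le> s \<and> s \<le> \<phi> \<and> Re w = s * cos \<alpha> \<and> \<bar>Im w\<bar> = \<bar>s * sin \<alpha>\<bar>)"
    unfolding abs_eq_iff complex_eq_iff by auto
  finally show ?thesis .
qed

lemma cis_mult_cancel_segment:
  "cis \<alpha> * w \<in> closed_segment (cis \<alpha> * a) (cis \<alpha> * b) \<longleftrightarrow> w \<in> closed_segment a b"
proof -
  have "(1 - u) *\<^sub>R (cis \<alpha> * a) + u *\<^sub>R (cis \<alpha> * b) = cis \<alpha> * ((1 - u) *\<^sub>R a + u *\<^sub>R b)" for u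
    by (simp add: algebra_simps)
  then show ?thesis by (simp add: in_segment)
qed

text \<open>The sign \<open>e\<close> selects the edge: \<open>-1\<close> starts at
  \<open>A\<close>, \<open>1\<close> at \<open>B\<close>. The segment parameter is
  \<open>t * sb / (\<phi> * sa)\<close>, since \<open>P\<close> is reached when the transverse
  coordinate vanishes, at \<open>t = \<phi> * sa / sb\<close>.\<close>

lemma mem_edge_AP_iff:
  fixes \<phi> ca sa cb sb e :: real
  assumes "0 < \<phi>" "0 < sa" "0 < sb"
  shows "w \<in> closed_segment (Complex (\<phi> * ca) (e * (\<phi> * sa))) (Complex (\<phi> * (ca + sa * (cb / sb))) 0) \<longleftrightarrow>
    (\<exists>t. 0 \<le> t \<and> t * sb \<le> \<phi> * sa \<and> Re w = \<phi> * ca + t * cb \<and> Im w = e * (\<phi> * sa - t * sb))"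
    (is "_ \<longleftrightarrow> ?R")
proof
  assume "w \<in> closed_segment (Complex (\<phi> * ca) (e * (\<phi> * sa))) (Complex (\<phi> * (ca + sa * (cb / sb))) 0)"
  then obtain x where x: "0 \<le> x" "x \<le> 1"
    "w = (1 - x) *\<^sub>R Complex (\<phi> * ca) (e * (\<phi> * sa)) + x *\<^sub>R Complex (\<phi> * (ca + sa * (cb / sb))) 0"
    by (auto simp: in_segment)
  have "x * (\<phi> * sa) \<le> \<phi> * sa" using x assms by (simp add: mult_left_le_one_le)
  moreover have "Re w = (1 - x) * (\<phi> * ca) + x * (\<phi> * (ca + sa * (cb / sb)))"
    "Im w = (1 - x) * (e * (\<phi> * sa))" using x(3) by simp_all
  ultimately show ?R using x(1,2) assms
    by (intro exI[of _ "x * \<phi> * sa / sb"]) (auto simp: field_simps)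
next
  assume ?R
  then obtain t where t: "0 \<le> t" "t * sb \<le> \<phi> * sa" "Re w = \<phi> * ca + t * cb" "Im w = e * (\<phi> * sa - t * sb)"
    by blast
  define x where "x = t * sb / (\<phi> * sa)"
  have "0 \<le> x" "x \<le> 1" using t assms by (auto simp: x_def)
  moreover have "t = x * \<phi> * sa / sb" using assms by (simp add: x_def)
  then have "w = (1 - x) *\<^sub>R Complex (\<phi> * ca) (e * (\<phi> * sa)) + x *\<^sub>R Complex (\<phi> * (ca + sa * (cb / sb))) 0"
    using t assms by (auto simp: complex_eq_iff field_simps)
  ultimately show "w \<in> closed_segment (Complex (\<phi> * ca) (e * (\<phi> * sa))) (Complex (\<phi> * (ca + sa * (cb / sb))) 0)"
    unfolding in_segment by blast
qed

lemma omega_eq_cis: "omega n = cis (2 * (pi / real n))"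
  by (simp add: omega_def)

text \<open>The factors \<open>-1\<close> and \<open>1\<close> are written out so that
  \<open>A\<close> and \<open>B\<close> match the sign \<open>e\<close> of
  \<open>mem_edge_AP_iff\<close>.\<close>

lemma pt_eqs:
  fixes n k :: nat
  defines "\<alpha> \<equiv> pi / real n" and "\<beta> \<equiv> (real k - 1) * pi / real n"
  shows "pt_A n k = cis \<alpha> * Complex (phi n k * cos \<alpha>) (-1 * (phi n k * sin \<alpha>))"
    "pt_B n k = cis \<alpha> * Complex (phi n k * cos \<alpha>) (1 * (phi n k * sin \<alpha>))"
    "pt_P n k = cis \<alpha> * Complex (phi n k * (cos \<alpha> + sin \<alpha> * (cos \<beta> / sin \<beta>))) 0"
proof -
  have "Complex (phi n k * cos \<alpha>) (-1 * (phi n k * sin \<alpha>)) = of_real (phi n k) * cis (- \<alpha>)"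
    by (simp add: complex_eq_iff)
  then show "pt_A n k = cis \<alpha> * Complex (phi n k * cos \<alpha>) (-1 * (phi n k * sin \<alpha>))"
    by (simp add: pt_A_def cis_mult mult.left_commute)
  have "Complex (phi n k * cos \<alpha>) (1 * (phi n k * sin \<alpha>)) = of_real (phi n k) * cis \<alpha>"
    by (simp add: complex_eq_iff)
  then show "pt_B n k = cis \<alpha> * Complex (phi n k * cos \<alpha>) (1 * (phi n k * sin \<alpha>))"
    by (simp add: pt_B_def cis_mult mult.left_commute omega_eq_cis \<alpha>_def)
  show "pt_P n k = cis \<alpha> * Complex (phi n k * (cos \<alpha> + sin \<alpha> * (cos \<beta> / sin \<beta>))) 0"
    by (simp add: pt_P_def cot_def complex_eq_iff \<alpha>_def \<beta>_def)
qed

text \<open>\<open>O A\<close> and \<open>O B\<close> lie where the sector gap vanishes, the other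
  two edges where the edge gap does; \<open>edge_coordinates_iff\<close> with
  \<open>u = Re w\<close> and \<open>m = \<bar>Im w\<bar>\<close> matches their endpoints with the
  inequalities.\<close>

lemma Pi_boundary_eq:
  assumes "n > 2" "1 \<le> k" "k < n"
  shows "Pi_boundary n k = {z \<in> cell n k. sector_gap n z = 0 \<or> edge_gap n k z = 0}"
proof (rule set_eqI)
  fix z
  define \<alpha> \<beta> \<phi> where "\<alpha> = pi / real n" and "\<beta> = (real k - 1) * pi / real n" and "\<phi> = phi n k"
  note defs = \<alpha>_def[symmetric] \<beta>_def[symmetric] \<phi>_def[symmetric]
  note ang = angle_facts[OF assms, unfolded defs]
  have phi: "\<phi> > 0" using phi_pos[of n k] assms by (simp add: \<phi>_def)
  obtain w where z: "z = cis \<alpha> * w" using cis_rotate_obtain by blast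
  have OAB: "z \<in> closed_segment 0 (pt_A n k) \<union> closed_segment 0 (pt_B n k) \<longleftrightarrow>
    (\<exists>s. 0 \<le> s \<and> s \<le> \<phi> \<and> Re w = s * cos \<alpha> \<and> \<bar>Im w\<bar> = s * sin \<alpha>)"
  proof -
    have "pt_A n k = of_real \<phi>" "pt_B n k = of_real \<phi> * cis (2 * \<alpha>)"
      by (simp_all add: pt_A_def pt_B_def \<phi>_def \<alpha>_def omega_eq_cis)
    then have "z \<in> closed_segment 0 (pt_A n k) \<union> closed_segment 0 (pt_B n k) \<longleftrightarrow>
      (\<exists>s. 0 \<le> s \<and> s \<le> \<phi> \<and> Re w = s * cos \<alpha> \<and> \<bar>Im w\<bar> = \<bar>s * sin \<alpha>\<bar>)"
      using mem_edge_OA_OB_iff[of \<phi> \<alpha> w] phi z by simp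
    moreover have "\<bar>s * sin \<alpha>\<bar> = s * sin \<alpha>" if "0 \<le> s" for s using that ang by simp
    ultimately show ?thesis by (metis (no_types))
  qed
  define E where "E = (if k = 1 then ray (pt_A n k) \<alpha> \<union> ray (pt_B n k) \<alpha>
    else closed_segment (pt_A n k) (pt_P n k) \<union> closed_segment (pt_P n k) (pt_B n k))"
  have edge: "z \<in> E \<longleftrightarrow>
    (\<exists>t. 0 \<le> t \<and> t * sin \<beta> \<le> \<phi> * sin \<alpha> \<and> Re w = \<phi> * cos \<alpha> + t * cos \<beta> \<and> \<bar>Im w\<bar> = \<phi> * sin \<alpha> - t * sin \<beta>)"
    (is "_ \<longleftrightarrow> ?R")
  proof -
    have "z \<in> E \<longleftrightarrow> (\<exists>e\<in>{-1, 1}. \<exists>t. 0 \<le> t \<and> t * sin \<beta> \<le> \<phi> * sin \<alpha> \<and>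
        Re w = \<phi> * cos \<alpha> + t * cos \<beta> \<and> Im w = e * (\<phi> * sin \<alpha> - t * sin \<beta>))" (is "_ \<longleftrightarrow> ?Q")
    proof (cases "k = 1")
      case True
      then have \<beta>0: "\<beta> = 0" by (simp add: \<beta>_def)
      have "z = cis \<alpha> * c + of_real t * cis \<alpha> \<longleftrightarrow> w = c + of_real t" for c t
      proof -
        have "cis \<alpha> * c + of_real t * cis \<alpha> = cis \<alpha> * (c + of_real t)" by (simp add: algebra_simps)
        then show ?thesis by (simp add: z)
      qed
      then have "z \<in> ray (cis \<alpha> * c) \<alpha> \<longleftrightarrow> (\<exists>t\<ge>0. w = c + of_real t)" for c
        by (auto simp: ray_def)
      then show ?thesis
        using phi ang unfolding E_def pt_eqs[of n k, unfolded defs]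
        by (auto simp: True \<beta>0 complex_eq_iff)
    next
      case False
      then have "sin \<beta> > 0" using ang by simp
      then show ?thesis using False phi ang
        unfolding E_def pt_eqs[of n k, unfolded defs] z
        \<comment> \<open>Reverses \<open>P B\<close>, so that both edges run towards
          \<open>P\<close>.\<close>
        by (subst closed_segment_commute[of _ "cis \<alpha> * Complex (\<phi> * cos \<alpha>) (1 * (\<phi> * sin \<alpha>))"])
          (simp only: if_False Un_iff cis_mult_cancel_segment mem_edge_AP_iff bex_simps simp_thms)
    qed
    also have "?Q \<longleftrightarrow> ?R"
    proof -
      \<comment> \<open>Up to \<open>P\<close> the transverse coordinate is nonnegative, so the
        choice of sign \<open>e\<close> is the same as an absolute value.\<close>
      have "\<bar>x\<bar> = y \<longleftrightarrow> (\<exists>e\<in>{-1, 1}. x = e * y)" if "0 \<le> y" for x y :: real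
        using that by auto
      then have "\<forall>t. t * sin \<beta> \<le> \<phi> * sin \<alpha> \<longrightarrow>
          (\<bar>Im w\<bar> = \<phi> * sin \<alpha> - t * sin \<beta> \<longleftrightarrow> (\<exists>e\<in>{-1, 1}. Im w = e * (\<phi> * sin \<alpha> - t * sin \<beta>)))"
        by (metis diff_ge_0_iff_ge)
      then show ?thesis by blast
    qed
    finally show ?thesis .
  qed
  have "z \<in> Pi_boundary n k \<longleftrightarrow> z \<in> closed_segment 0 (pt_A n k) \<union> closed_segment 0 (pt_B n k) \<or> z \<in> E"
    unfolding Pi_boundary_def E_def \<alpha>_def closed_segment_commute[of "pt_B n k" 0] by auto
  also have "\<dots> \<longleftrightarrow> \<bar>Im w\<bar> * cos \<alpha> \<le> Re w * sin \<alpha> \<and>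
      Re w * sin \<beta> + \<bar>Im w\<bar> * cos \<beta> \<le> \<phi> * (sin \<alpha> * cos \<beta> + cos \<alpha> * sin \<beta>) \<and>
      (\<bar>Im w\<bar> * cos \<alpha> = Re w * sin \<alpha> \<or> Re w * sin \<beta> + \<bar>Im w\<bar> * cos \<beta> = \<phi> * (sin \<alpha> * cos \<beta> + cos \<alpha> * sin \<beta>))"
    unfolding OAB edge
    by (rule edge_coordinates_iff[symmetric]) (use ang phi in auto)
  also have "\<dots> \<longleftrightarrow> z \<in> {z \<in> cell n k. sector_gap n z = 0 \<or> edge_gap n k z = 0}"
    using gap_cis(1)[of n w, unfolded defs] gap_cis(2)[of n k w, unfolded defs] ang(4)
    by (auto simp: cell_def z)
  finally show "z \<in> Pi_boundary n k \<longleftrightarrow> z \<in> {z \<in> cell n k. sector_gap n z = 0 \<or> edge_gap n k z = 0}" .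
qed

section \<open>Identification of \<open>Pi_set\<close> with \<open>cell\<close>\<close>

text \<open>A factor \<open>t \<ge> 0\<close> passes through the absolute values. The edge gap at
  \<open>0\<close> is \<open>phi n k * sin (real k * pi / real n)\<close>, so for
  \<open>t \<le> 1\<close> the second formula is a convex combination of the gaps at
  \<open>0\<close> and \<open>z\<close>.\<close>

lemma gap_scale:
  assumes "0 \<le> t"
  shows "sector_gap n (t *\<^sub>R z) = t * sector_gap n z"
    "edge_gap n k (t *\<^sub>R z) =
      (1 - t) * (phi n k * sin (real k * pi / real n)) + t * edge_gap n k z"
proof -
  have re: "Re (cis a * (t *\<^sub>R z)) = t * Re (cis a * z)" for a
    by (simp only: mult_scaleR_right scaleR_complex.sel)
  have im: "\<bar>Im (cis a * (t *\<^sub>R z))\<bar> = t * \<bar>Im (cis a * z)\<bar>" for a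
    by (simp only: mult_scaleR_right scaleR_complex.sel abs_mult abs_of_nonneg[OF assms])
  show "sector_gap n (t *\<^sub>R z) = t * sector_gap n z"
    "edge_gap n k (t *\<^sub>R z) =
      (1 - t) * (phi n k * sin (real k * pi / real n)) + t * edge_gap n k z"
    unfolding sector_gap_def edge_gap_def re im by algebra+
qed

text \<open>Starlikeness is used instead of convexity: when
  \<open>cos ((real k - 1) * pi / real n) < 0\<close> the quadrilateral has a reflex angle at
  \<open>P\<close>.\<close>

lemma scale_mem_cell:
  assumes "n > 2" "1 \<le> k" "k < n" "z \<in> cell n k" "0 \<le> t" "t \<le> 1"
  shows "t *\<^sub>R z \<in> cell n k"
proof -
  have "0 \<le> phi n k * sin (real k * pi / real n)"
    using phi_pos[of n k] angle_facts[OF assms(1-3)] assms by simp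
  then show ?thesis using assms by (auto simp: cell_def gap_scale)
qed

lemma continuous_on_gap [continuous_intros]:
  "continuous_on S (sector_gap n)" "continuous_on S (edge_gap n k)"
  unfolding sector_gap_def edge_gap_def by (intro continuous_intros)+

text \<open>The strict inequalities cut out an open subset of the closed cell, so at a frontier
  point one gap vanishes.\<close>

lemma frontier_cell:
  assumes "n > 2" "1 \<le> k" "k < n"
  shows "frontier (cell n k) \<subseteq> Pi_boundary n k"
proof -
  let ?V = "{z. 0 < sector_gap n z} \<inter> {z. 0 < edge_gap n k z}"
  have "open ?V" by (intro open_Int open_Collect_less continuous_intros)
  then have "?V \<subseteq> interior (cell n k)"
    by (intro interior_maximal) (auto simp: cell_def)
  moreover have "closed (cell n k)"
    unfolding cell_def by (intro closed_Collect_conj closed_Collect_le continuous_intros)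
  ultimately have "frontier (cell n k) \<subseteq> cell n k - ?V"
    by (auto simp: frontier_def)
  then show ?thesis unfolding Pi_boundary_eq[OF assms] by (auto simp: cell_def)
qed

lemma bounded_cell:
  assumes "n > 2" "1 \<le> k" "k < n" "k \<noteq> 1"
  shows "bounded (cell n k)"
proof -
  define ca sa cb sb where "ca = cos (pi / real n)" and "sa = sin (pi / real n)"
    and "cb = cos ((real k - 1) * pi / real n)" and "sb = sin ((real k - 1) * pi / real n)"
  define \<phi> q where "\<phi> = phi n k" and "q = sin (real k * pi / real n)"
  note defs = ca_def[symmetric] sa_def[symmetric] cb_def[symmetric] sb_def[symmetric]
    \<phi>_def[symmetric] q_def[symmetric]
  have pos: "0 < ca" "0 < sa" "0 < q" "q = sa * cb + ca * sb" "0 < sb" "0 < \<phi>"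
    using angle_facts[OF assms(1-3), unfolded defs] phi_pos[of n k] assms
    by (simp_all add: \<phi>_def)
  have "ca \<le> 1" by (simp add: ca_def)
  \<comment> \<open>Dominates both bounds for \<open>u\<close> below: \<open>\<phi> * q / sb\<close>
    if \<open>cb \<ge> 0\<close>, and \<open>\<phi> * ca\<close> otherwise.\<close>
  define K where "K = \<phi> + \<phi> * q / sb"
  have "norm z \<le> K + K * sa / ca" if z: "z \<in> cell n k" for z
  proof -
    obtain w where w: "z = cis (pi / real n) * w" using cis_rotate_obtain by blast
    define u m where "u = Re w" and "m = \<bar>Im w\<bar>"
    have m: "m * ca \<le> u * sa" and e: "u * sb + m * cb \<le> \<phi> * q" and "0 \<le> m"
      using z gap_cis(1)[of n w] gap_cis(2)[of n k w] by (auto simp: cell_def defs w u_def m_def)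
    have "0 \<le> m * ca" using pos \<open>0 \<le> m\<close> by simp
    then have "0 \<le> u * sa" using m by linarith
    then have "0 \<le> u" using pos by (simp add: zero_le_mult_iff)
    have u: "u \<le> K"
    proof (cases "0 \<le> cb")
      case True
      then have "0 \<le> m * cb" using \<open>0 \<le> m\<close> by simp
      then have "u * sb \<le> \<phi> * q" using e by simp
      then have "u \<le> \<phi> * q / sb" using pos by (simp add: field_simps)
      then show ?thesis using pos by (simp add: K_def)
    next
      case False
      \<comment> \<open>With \<open>cb < 0\<close> the edge inequality weakens as \<open>m\<close>
        grows; the sector inequality, multiplied by \<open>cb\<close>, eliminates
        \<open>m\<close>.\<close>
      then have "u * sa * cb \<le> m * ca * cb" using m by (intro mult_right_mono_neg) auto
      moreover have "(u * sb + m * cb) * ca \<le> \<phi> * q * ca" using e pos by (intro mult_right_mono) auto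
      ultimately have "u * q \<le> (\<phi> * ca) * q"
        using pos(4) by (simp add: algebra_simps)
      then have "u \<le> \<phi> * ca" using pos by simp
      also have "\<dots> \<le> \<phi>" using pos \<open>ca \<le> 1\<close> by simp
      also have "\<dots> \<le> K" using pos by (simp add: K_def)
      finally show ?thesis .
    qed
    have "m \<le> u * sa / ca" using m pos by (simp add: field_simps)
    also have "\<dots> \<le> K * sa / ca" using u pos by (intro divide_right_mono mult_right_mono) auto
    finally have "u + m \<le> K + K * sa / ca" using u by simp
    moreover have "norm z \<le> u + m"
      using cmod_le[of w] \<open>0 \<le> u\<close> by (simp add: w norm_mult u_def m_def)
    ultimately show ?thesis by simp
  qed
  then show ?thesis by (auto simp: bounded_iff)
qed

text \<open>For \<open>k > 1\<close> the cell is bounded and starlike, so it is its boundary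
  together with the inside. For \<open>k = 1\<close> the strict inequalities define a convex set,
  which lies in a single component of the complement; that component cannot leave the cell without
  meeting its frontier.\<close>

lemma Pi_set_eq_cell:
  assumes "n > 2" "1 \<le> k" "k < n"
  shows "Pi_set n k = cell n k"
proof (cases "k = 1")
  case False
  have "0 \<in> cell n k"
    using phi_pos[of n k] angle_facts[OF assms] assms
    by (simp add: cell_def sector_gap_def edge_gap_def)
  then have "Pi_boundary n k \<union> inside (Pi_boundary n k) = cell n k"
    using frontier_cell[OF assms] bounded_cell[OF assms False] scale_mem_cell[OF assms]
    by (intro starshaped_eq_Un_inside) (auto simp: Pi_boundary_eq[OF assms])
  then show ?thesis using False by (simp add: Pi_set_def)
next
  case True
  let ?p = "cis (pi / real n)"
  let ?C = "connected_component_set (- Pi_boundary n k) ?p"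
  let ?V = "{z. 0 < sector_gap n z \<and> 0 < edge_gap n k z}"
  note ang = angle_facts[OF assms]
  have phi: "phi n k > 0" using phi_pos[of n k] assms by simp
  have p: "?p \<in> ?V"
    using gap_cis(1)[of n 1] gap_cis(2)[of n k 1] ang phi True by simp
  \<comment> \<open>For \<open>k = 1\<close> the coefficients of the absolute values have the right
    sign, so \<open>?V\<close> is an intersection of four open half planes.\<close>
  have "convex ?V"
  proof -
    let ?R = "\<lambda>z. Re (cis (- (pi / real n)) * z)" and ?I = "\<lambda>z. Im (cis (- (pi / real n)) * z)"
    let ?c = "cos (pi / real n)" and ?s = "sin (pi / real n)"
    have lin: "linear (\<lambda>z. a * ?R z + b * ?I z)" for a b
      by (intro linearI) (simp_all add: algebra_simps)
    have half: "convex {z. 0 < d + (a * ?R z + b * ?I z)}" for a b d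
    proof -
      have "{z. 0 < d + (a * ?R z + b * ?I z)} = (\<lambda>z. a * ?R z + b * ?I z) -` {- d<..}" by auto
      then show ?thesis using convex_linear_vimage[OF lin] by simp
    qed
    have abs: "0 < r * s - \<bar>i\<bar> * c \<longleftrightarrow> 0 < 0 + (s * r + c * i) \<and> 0 < 0 + (s * r + (- c) * i)"
      if "0 < c" for r s i c :: real
    proof -
      have "\<bar>i\<bar> * c = \<bar>c * i\<bar>" using that by (simp add: abs_mult)
      then show ?thesis by (auto simp: mult.commute)
    qed
    have abs': "0 < f * s - (r * 0 + \<bar>i\<bar> * 1) \<longleftrightarrow> 0 < f * s + (0 * r + 1 * i) \<and> 0 < f * s + (0 * r + (- 1) * i)"
      for f r s i :: real by auto
    have k1: "real k * pi / real n = pi / real n" "(real k - 1) * pi / real n = 0"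
      using True by simp_all
    have "?V = {z. 0 < 0 + (?s * ?R z + ?c * ?I z)} \<inter> {z. 0 < 0 + (?s * ?R z + (- ?c) * ?I z)} \<inter>
        {z. 0 < phi n k * ?s + (0 * ?R z + 1 * ?I z)} \<inter> {z. 0 < phi n k * ?s + (0 * ?R z + (- 1) * ?I z)}"
      unfolding sector_gap_def edge_gap_def k1 sin_zero cos_zero abs[OF ang(1)] abs' by blast
    then show ?thesis by (simp only:) (intro convex_Int half)
  qed
  then have "connected ?V" by (rule convex_connected)
  moreover have "?V \<subseteq> - Pi_boundary n k" unfolding Pi_boundary_eq[OF assms] by auto
  ultimately have V: "?V \<subseteq> ?C" using p by (intro connected_component_maximal)
  have "cell n k \<subseteq> Pi_boundary n k \<union> ?V"
    unfolding Pi_boundary_eq[OF assms] by (auto simp: cell_def less_le)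
  with V have "cell n k \<subseteq> Pi_boundary n k \<union> ?C" by blast
  moreover have "?C \<subseteq> cell n k"
  proof -
    have "?C \<inter> frontier (cell n k) = {}"
      using frontier_cell[OF assms] connected_component_subset[of "- Pi_boundary n k" ?p] by blast
    moreover have "?p \<in> ?C \<inter> cell n k" using p V by (auto simp: cell_def)
    ultimately show ?thesis using connected_Int_frontier[of ?C "cell n k"] by blast
  qed
  moreover have "Pi_boundary n k \<subseteq> cell n k" unfolding Pi_boundary_eq[OF assms] by blast
  ultimately show ?thesis using True unfolding Pi_set_def by auto
qed

section \<open>Rotated sectors and the shape of \<open>Omega\<close>\<close>

lemma sector_cover:
  assumes "n > 2"
  obtains j z' where "j < n" "z = omega n ^ j * z'" "0 \<le> sector_gap n z'"
proof -
  define a where "a = pi / real n"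
  have a: "0 < a" "2 * a \<le> pi" "real n * (2 * a) = 2 * pi" using assms by (auto simp: a_def field_simps)
  define \<theta> where "\<theta> = Arg2pi z"
  have \<theta>: "0 \<le> \<theta>" "\<theta> < 2 * pi" "z = of_real (norm z) * cis \<theta>"
    using Arg2pi[of z] Arg2pi_eq[of z] by (auto simp: \<theta>_def cis_conv_exp)
  \<comment> \<open>The sectors have opening \<open>2 * a\<close>; \<open>j\<close> numbers the one
    containing the argument of \<open>z\<close>.\<close>
  define j where "j = nat \<lfloor>\<theta> / (2 * a)\<rfloor>"
  have "0 \<le> \<theta> / (2 * a)" using \<theta> a by simp
  then have j: "real j \<le> \<theta> / (2 * a)" "\<theta> / (2 * a) < real j + 1"
    unfolding j_def by linarith+
  then have j': "real j * (2 * a) \<le> \<theta>" "\<theta> < (real j + 1) * (2 * a)"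
    using a by (simp_all add: field_simps)
  \<comment> \<open>The angle measured from the bisector of that sector, so
    \<open>- a \<le> g \<le> a\<close>.\<close>
  define g where "g = \<theta> - real j * (2 * a) - a"
  have g: "0 \<le> a + g" "0 \<le> a - g" "a + g \<le> pi" "a - g \<le> pi"
    using j' a by (auto simp: g_def algebra_simps)
  define w where "w = of_real (norm z) * cis g"
  show thesis
  proof
    have "real j * (2 * a) < real n * (2 * a)" using j' \<theta> a by linarith
    then have "real j < real n" by (rule mult_right_less_imp_less) (use a in simp)
    then show "j < n" by simp
    have "omega n ^ j * (cis a * cis g) = cis \<theta>"
      by (simp add: omega_def Complex.DeMoivre cis_mult g_def a_def)
    then have "cis \<theta> = omega n ^ j * (cis a * cis g)" by simp
    then show "z = omega n ^ j * (cis a * w)"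
      using \<theta>(3) by (simp add: w_def mult_ac)
    \<comment> \<open>By the addition formulas these are the two signs of the sector
      inequality.\<close>
    have "0 \<le> sin (a + g)" "0 \<le> sin (a - g)" using g by (auto intro: sin_ge_zero)
    then have "\<bar>sin g\<bar> * cos a \<le> cos g * sin a"
      by (auto simp: sin_add sin_diff abs_if mult.commute)
    then have "norm z * (\<bar>sin g\<bar> * cos a) \<le> norm z * (cos g * sin a)"
      by (rule mult_left_mono) simp
    then show "0 \<le> sector_gap n (cis a * w)"
      unfolding a_def gap_cis by (simp add: w_def a_def abs_mult mult.assoc)
  qed
qed

text \<open>The union \<open>U\<close> of the rotated cells contains a ball about \<open>0\<close>
  and is preserved by the rotation and by scalings with \<open>0 < t \<le> 1\<close>. These maps are
  open, so they preserve \<open>interior U\<close> as well.\<close>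

lemma Omega_properties:
  assumes "n > 2" "1 \<le> k" "k < n"
  shows "0 \<in> Omega n k" "connected (Omega n k)"
    "z \<in> Omega n k \<Longrightarrow> omega n * z \<in> Omega n k"
proof -
  define U where "U = (\<Union>j<n. (\<lambda>z. omega n ^ j * z) ` cell n k)"
  have Om: "Omega n k = interior U"
    by (simp add: Omega_def U_def Pi_set_eq_cell[OF assms])
  \<comment> \<open>Half the constant term of \<open>edge_gap\<close>: each of the two subtracted
    terms is at most the norm, hence below \<open>d\<close>.\<close>
  define d where "d = phi n k * sin (real k * pi / real n) / 2"
  have d: "d > 0" using phi_pos[of n k] angle_facts[OF assms] assms by (simp add: d_def)
  have "ball 0 d \<subseteq> U"
  proof
    fix z :: complex assume z: "z \<in> ball 0 d"
    obtain j z' where j: "j < n" "z = omega n ^ j * z'" "0 \<le> sector_gap n z'"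
      using sector_cover[OF assms(1)] by blast
    let ?w = "cis (- (pi / real n)) * z'"
    have nw: "norm ?w < d" using z j by (simp add: norm_mult norm_power)
    have 1: "x * y \<le> norm ?w" if "\<bar>x\<bar> \<le> norm ?w" "\<bar>y\<bar> \<le> 1" for x y :: real
    proof -
      have "x * y \<le> \<bar>x\<bar> * \<bar>y\<bar>" by (metis abs_ge_self abs_mult)
      also have "\<dots> \<le> \<bar>x\<bar>" using that by (simp add: mult_left_le)
      finally show ?thesis using that by simp
    qed
    have "Re ?w * sin ((real k - 1) * pi / real n) \<le> norm ?w"
      "\<bar>Im ?w\<bar> * cos ((real k - 1) * pi / real n) \<le> norm ?w"
      by (intro 1; simp only: abs_idempotent abs_Re_le_cmod abs_Im_le_cmod abs_sin_le_one abs_cos_le_one)+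
    then have "0 \<le> edge_gap n k z'"
      using nw unfolding edge_gap_def d_def by linarith
    then show "z \<in> U" using j by (auto simp: U_def cell_def)
  qed
  then have "ball 0 d \<subseteq> interior U" by (simp add: interior_maximal)
  then show zero: "0 \<in> Omega n k" using d by (auto simp: Om)
  have scale: "(*\<^sub>R) t ` interior U \<subseteq> interior U" if "0 < t" "t \<le> 1" for t
  proof (rule interior_maximal)
    show "open ((*\<^sub>R) t ` interior U)" using that by (intro open_scaling) auto
    have "t *\<^sub>R z \<in> U" if z: "z \<in> U" for z
    proof -
      obtain j y where y: "j < n" "y \<in> cell n k" "z = omega n ^ j * y" using z by (auto simp: U_def)
      then have "t *\<^sub>R y \<in> cell n k" using scale_mem_cell[OF assms] \<open>0 < t\<close> \<open>t \<le> 1\<close> by simp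
      moreover have "t *\<^sub>R z = omega n ^ j * (t *\<^sub>R y)" using y by simp
      ultimately show ?thesis
        unfolding U_def using y by (intro UN_I[of j] image_eqI[of _ _ "t *\<^sub>R y"]) auto
    qed
    then show "(*\<^sub>R) t ` interior U \<subseteq> U" using interior_subset by blast
  qed
  \<comment> \<open>Scaling by \<open>t = 0\<close> is not open; that case is the membership of
    \<open>0\<close>.\<close>
  have "t *\<^sub>R z \<in> interior U" if "z \<in> interior U" "0 \<le> t" "t \<le> 1" for z t
    using scale[of t] that zero Om by (cases "t = 0") auto
  then have "starlike (Omega n k)"
    unfolding starlike_def Om using zero Om by (intro bexI[of _ 0]) (auto simp: in_segment)
  then show "connected (Omega n k)" by (rule starlike_imp_connected)
  have "(*) (omega n) ` interior U \<subseteq> interior U"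
  proof (rule interior_maximal)
    have "omega n \<noteq> 0" by (simp add: omega_def)
    then show "open ((*) (omega n) ` interior U)"
      by (intro open_times_image) auto
    have "omega n * z \<in> U" if z: "z \<in> U" for z
    proof -
      obtain j y where y: "j < n" "y \<in> cell n k" "z = omega n ^ j * y" using z by (auto simp: U_def)
      show ?thesis
      \<comment> \<open>The last copy is rotated onto the copy with index \<open>0\<close>, by
        \<open>omega n ^ n = 1\<close>.\<close>
      proof (cases "Suc j = n")
        case True
        have "omega n ^ Suc j = 1" unfolding True using assms(1) by simp
        then have "omega n * omega n ^ j = 1" by simp
        then have "omega n * z = y"
          unfolding y(3) by (simp only: mult.assoc[symmetric] mult_1)
        then show ?thesis
          unfolding U_def using y(1,2) by (intro UN_I[of 0] image_eqI[of _ _ y]) auto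
      next
        case False
        have "omega n * z = omega n ^ Suc j * y" using y by simp
        then show ?thesis using y False unfolding U_def by (intro UN_I[of "Suc j"]) auto
      qed
    qed
    then show "(*) (omega n) ` interior U \<subseteq> U" using interior_subset by blast
  qed
  then show "z \<in> Omega n k \<Longrightarrow> omega n * z \<in> Omega n k" by (auto simp: Om)
qed

theorem proposition5:
  fixes n k :: nat and S :: "complex \<Rightarrow> complex"
  assumes "n > 2" and "1 \<le> k" and "k < n"
    and "is_gen_sin n k S"
  shows "\<forall>z\<in>Omega n k. S (omega n * z) = omega n * S z"
  using is_gen_sin_omega[of n k S] Omega_properties[of n k] assms by simp

end
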